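(* Let $\mathbf{T}:\mathbb{Z}^d\curvearrowright(X,\mu)$ be a Følner rank one action, with stacking towers $\{\mathcal{T}_n\}$ of shapes $\{F_n\}$ ($\{F_n\}$ a Følner sequence) fixed and descendant sets $I_{m,n}$ defined from these towers. Let $G$ be a finite-index subgroup of $\mathbb{Z}^d$. Then the following are equivalent: (1) $G\in\mathcal{FF}(\mathbf{T})$, i.e. $(X,\mu,\mathbf{T})$ factors onto the finite odometer $(\mathbb{Z}^d/G,\delta,\tau)$. (2) For every $\epsilon>0$ there exists $N\in\mathbb{N}$ so that for all $n\ge m\ge N$ there is $\mathbf{g}\in\mathbb{Z}^d$ such that $$\frac{\#(\{\mathbf{i}\in I_{m,n}:\mathbf{i}\not\equiv\mathbf{g}\bmod G\})}{\#(I_{m,n})}<\epsilon.$$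
   Context: Measure-preserving $\mathbb{Z}^d$-action $\mathbf{T}:\mathbb{Z}^d\curvearrowright(X,\mu)$: $(X,\mathcal{X},\mu)$ is a (non-atomic) Lebesgue probability space, or a finite set with normalized counting measure; for each $\mathbf{v}\in\mathbb{Z}^d$, $\mathbf{T}^{\mathbf{v}}:X\to X$ is an invertible measurable measure-preserving map, with $\mathbf{T}^{\mathbf{v}+\mathbf{w}}=\mathbf{T}^{\mathbf{v}}\circ\mathbf{T}^{\mathbf{w}}$ and $\mathbf{T}^{\mathbf{0}}=\mathrm{id}$. $(X,\mu,\mathbf{T})$ factors onto $(Y,\nu,\mathbf{S})$ if there is a measurable $\phi:X\to Y$ (a factor map) whose push-forward of $\mu$ is $\nu$ and with $\phi(\mathbf{T}^{\mathbf{v}}(x))=\mathbf{S}^{\mathbf{v}}(\phi(x))$ for a.e. $x$ and every $\mathbf{v}$. Finite odometer: for a finite-index subgroup $G\le\mathbb{Z}^d$, $\delta$ is the uniform probability measure on $\mathbb{Z}^d/G$ and $\tau^{\mathbf{v}}(\mathbf{g}+G)=\mathbf{g}+\mathbf{v}+G$. $\mathcal{FF}(\mathbf{T})$ is the set of all finite-index subgroups $G\le\mathbb{Z}^d$ such that $(X,\mu,\mathbf{T})$ factors onto $(\mathbb{Z}^d/G,\delta,\tau)$. A shape is a nonempty finite subset of $\mathbb{Z}^d$. A sequence of shapes $\{F_n\}$ is a Følner sequence if $\#(F_n\triangle(F_n+\mathbf{v}))/\#(F_n)\to0$ for every $\mathbf{v}\in\mathbb{Z}^d$. A $\mathbf{T}$-tower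 of shape $R$ with base $B$ (measurable, $\mu(B)>0$) consists of the pairwise disjoint sets $\mathbf{T}^{\mathbf{v}}(B)$, $\mathbf{v}\in R$ (the levels), together with the error set $E=X\setminus\bigcup_{\mathbf{v}\in R}\mathbf{T}^{\mathbf{v}}(B)$. $\mathbf{T}$ is rank one for $\{F_n\}$ if there are $\mathbf{T}$-towers $\mathcal{T}_n$ of shape $F_n$ such that for every measurable $A$ there are sets $L_n$, each a union of levels of $\mathcal{T}_n$, with $\mu(L_n\triangle A)\to0$. $\mathbf{T}$ is Følner rank one if it is rank one for some Følner sequence $\{F_n\}$. The towers are stacking if for every $n$ each level of $\mathcal{T}_n$ is a union of levels of $\mathcal{T}_{n+1}$ and the error sets satisfy $E_{n+1}\subseteq E_n$. It is known that for a Følner rank one action (with $\mathbf{0}\in F_n$ for all $n$) the towers, of shapes $F_n$, can be chosen to be stacking and still such that for every measurable $A$ there are sets $L_n$, each a union of levels of $\mathcal{T}_n$, with $\mu(L_n\triangle A)\to0$; throughout, such towers $\mathcal{T}_n$, with bases $B_n$ and shapes $F_n\ni\mathbf{0}$, are fixed. For $n\ge m$, the descendant set is $I_{m,n}=\{\mathbf{i}\in F_n:\mathbf{T}^{\mathbf{i}}(B_n)\subseteq B_m\}$. *)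

theory Defs
  imports "HOL-Probability.Probability_Measure" "HOL-Algebra.Coset"
begin

section \<open>Measure-preserving actions of the integer lattice\<close>

text \<open>
  The lattice of rank \<open>d\<close> is the type \<^typ>\<open>int ^ 'd\<close>, with \<open>d = CARD('d)\<close>.
\<close>

definition iso_mod0 :: "'a measure \<Rightarrow> 'b measure \<Rightarrow> bool" where
  "iso_mod0 M N \<longleftrightarrow>
    (\<exists>U\<in>null_sets M. \<exists>V\<in>null_sets N. \<exists>f g.
      f \<in> measurable (restrict_space M (space M - U)) (restrict_space N (space N - V)) \<and>
      g \<in> measurable (restrict_space N (space N - V)) (restrict_space M (space M - U)) \<and>
      (\<forall>x\<in>space M - U. g (f x) = x) \<and>
      (\<forall>y\<in>space N - V. f (g y) = y) \<and>
      distr (restrict_space M (space M - U)) (restrict_space N (space N - V)) f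
        = restrict_space N (space N - V))"

text \<open>
  Taking the completion of \<open>M\<close> makes the definition cover both usages of the term: complete
  (Rokhlin) Lebesgue spaces, which agree with their completion, and standard Borel ones.
\<close>

definition nonatomic_lebesgue_space :: "'a measure \<Rightarrow> bool" where
  "nonatomic_lebesgue_space M \<longleftrightarrow>
    prob_space M \<and> iso_mod0 (completion M) (lebesgue_on {0..1::real})"

definition finite_uniform_space :: "'a measure \<Rightarrow> bool" where
  "finite_uniform_space M \<longleftrightarrow>
    finite (space M) \<and> space M \<noteq> {} \<and> M = uniform_count_measure (space M)"

text \<open>
  Each \<open>T v\<close> is automatically invertible on \<open>space M\<close>, with the measurable inverse \<open>T (- v)\<close>.
\<close>

definition mp_action :: "'a measure \<Rightarrow> (int ^ 'd \<Rightarrow> 'a \<Rightarrow> 'a) \<Rightarrow> bool" where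
  "mp_action M T \<longleftrightarrow>
    (nonatomic_lebesgue_space M \<or> finite_uniform_space M) \<and>
    (\<forall>v. T v \<in> measurable M M \<and> distr M M (T v) = M) \<and>
    (\<forall>v w. \<forall>x\<in>space M. T (v + w) x = T v (T w x)) \<and>
    (\<forall>x\<in>space M. T 0 x = x)"

definition factors_onto ::
    "'a measure \<Rightarrow> (int ^ 'd \<Rightarrow> 'a \<Rightarrow> 'a) \<Rightarrow> 'b measure \<Rightarrow> (int ^ 'd \<Rightarrow> 'b \<Rightarrow> 'b) \<Rightarrow> bool" where
  "factors_onto M T N S \<longleftrightarrow>
    (\<exists>\<phi>\<in>measurable M N. distr M N \<phi> = N \<and> (AE x in M. \<forall>v. \<phi> (T v x) = S v (\<phi> x)))"


section \<open>Finite odometers\<close>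

definition lattice_group :: "(int ^ 'd) monoid" where
  "lattice_group = \<lparr>carrier = UNIV, monoid.mult = (+), one = 0\<rparr>"

definition finite_index_subgroup :: "(int ^ 'd) set \<Rightarrow> bool" where
  "finite_index_subgroup G \<longleftrightarrow>
    subgroup G lattice_group \<and> finite (rcosets\<^bsub>lattice_group\<^esub> G)"

definition odometer_measure :: "(int ^ 'd) set \<Rightarrow> (int ^ 'd) set measure" where
  "odometer_measure G = uniform_count_measure (rcosets\<^bsub>lattice_group\<^esub> G)"

definition odometer_action :: "int ^ 'd \<Rightarrow> (int ^ 'd) set \<Rightarrow> (int ^ 'd) set" where
  "odometer_action v C = C #>\<^bsub>lattice_group\<^esub> v"

definition FF :: "'a measure \<Rightarrow> (int ^ 'd \<Rightarrow> 'a \<Rightarrow> 'a) \<Rightarrow> (int ^ 'd) set set" where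
  "FF M T =
    {G. finite_index_subgroup G \<and> factors_onto M T (odometer_measure G) odometer_action}"


section \<open>Towers and rank one\<close>

definition shape :: "(int ^ 'd) set \<Rightarrow> bool" where
  "shape R \<longleftrightarrow> finite R \<and> R \<noteq> {}"

definition folner_sequence :: "(nat \<Rightarrow> (int ^ 'd) set) \<Rightarrow> bool" where
  "folner_sequence F \<longleftrightarrow>
    (\<forall>n. shape (F n)) \<and>
    (\<forall>v. (\<lambda>n. real (card (sym_diff (F n) ((\<lambda>u. u + v) ` F n))) / real (card (F n)))
          \<longlonglongrightarrow> 0)"

text \<open>A tower is given by its shape \<open>R\<close> and its base \<open>B\<close>.\<close>

definition is_tower ::
    "'a measure \<Rightarrow> (int ^ 'd \<Rightarrow> 'a \<Rightarrow> 'a) \<Rightarrow> (int ^ 'd) set \<Rightarrow> 'a set \<Rightarrow> bool" where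
  "is_tower M T R B \<longleftrightarrow>
    shape R \<and> B \<in> sets M \<and> 0 < measure M B \<and> disjoint_family_on (\<lambda>v. T v ` B) R"

definition union_of_levels ::
    "(int ^ 'd \<Rightarrow> 'a \<Rightarrow> 'a) \<Rightarrow> (int ^ 'd) set \<Rightarrow> 'a set \<Rightarrow> 'a set \<Rightarrow> bool" where
  "union_of_levels T R B L \<longleftrightarrow> (\<exists>J\<subseteq>R. L = (\<Union>v\<in>J. T v ` B))"

definition error_set ::
    "'a measure \<Rightarrow> (int ^ 'd \<Rightarrow> 'a \<Rightarrow> 'a) \<Rightarrow> (int ^ 'd) set \<Rightarrow> 'a set \<Rightarrow> 'a set" where
  "error_set M T R B = space M - (\<Union>v\<in>R. T v ` B)"

definition rank_one_towers ::
    "'a measure \<Rightarrow> (int ^ 'd \<Rightarrow> 'a \<Rightarrow> 'a) \<Rightarrow> (nat \<Rightarrow> (int ^ 'd) set) \<Rightarrow> (nat \<Rightarrow> 'a set) \<Rightarrow> bool"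
  where
  "rank_one_towers M T F B \<longleftrightarrow>
    (\<forall>n. is_tower M T (F n) (B n)) \<and>
    (\<forall>A\<in>sets M. \<exists>L. (\<forall>n. union_of_levels T (F n) (B n) (L n)) \<and>
      (\<lambda>n. measure M (sym_diff (L n) A)) \<longlonglongrightarrow> 0)"

definition folner_rank_one :: "'a measure \<Rightarrow> (int ^ 'd \<Rightarrow> 'a \<Rightarrow> 'a) \<Rightarrow> bool" where
  "folner_rank_one M T \<longleftrightarrow> (\<exists>F B. folner_sequence F \<and> rank_one_towers M T F B)"

definition stacking ::
    "'a measure \<Rightarrow> (int ^ 'd \<Rightarrow> 'a \<Rightarrow> 'a) \<Rightarrow> (nat \<Rightarrow> (int ^ 'd) set) \<Rightarrow> (nat \<Rightarrow> 'a set) \<Rightarrow> bool"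
  where
  "stacking M T F B \<longleftrightarrow>
    (\<forall>n. \<forall>v\<in>F n. union_of_levels T (F (Suc n)) (B (Suc n)) (T v ` B n)) \<and>
    (\<forall>n. error_set M T (F (Suc n)) (B (Suc n)) \<subseteq> error_set M T (F n) (B n))"

definition descendants ::
    "(int ^ 'd \<Rightarrow> 'a \<Rightarrow> 'a) \<Rightarrow> (nat \<Rightarrow> (int ^ 'd) set) \<Rightarrow> (nat \<Rightarrow> 'a set)
      \<Rightarrow> nat \<Rightarrow> nat \<Rightarrow> (int ^ 'd) set" where
  "descendants T F B m n = {i\<in>F n. T i ` B n \<subseteq> B m}"

end

theory Submission
  imports Defs
begin

text \<open>
  Write \<open>I m n\<close> for the descendant set. Stacking makes \<open>B m\<close> the disjoint union of the levels
  \<open>T i ` B n\<close> with \<open>i \<in> I m n\<close>, all of the same measure, so proportions in \<open>I m n\<close> are proportions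
  of the measure of \<open>B m\<close>.

  Suppose first that \<open>\<phi>\<close> is a factor map onto the odometer. Levels of the towers approximate a fibre of
  \<open>\<phi>\<close>, so for large \<open>m\<close> some level lies almost entirely in that fibre; translating it back to the
  base, \<open>B m\<close> lies almost entirely in the fibre over some residue \<open>a\<close> (\<open>base_in_fibre\<close>). Likewise
  \<open>B n\<close> lies mostly over some residue \<open>c\<close>, whence \<open>T i ` B n\<close> lies mostly over \<open>c + i\<close>. A descendant
  \<open>i\<close> with \<open>c + i\<close> not congruent to \<open>a\<close> therefore wastes most of the measure of its level in the
  complement of the fibre over \<open>a\<close>, and few descendants can do so
  (\<open>incongruent_descendants_bound\<close>).

  Conversely, the map sending the level \<open>T v ` B n\<close> to the residue of \<open>v - c\<close> is almost equivariant
  when \<open>n\<close> is large: it fails to be so only on the error set and on the few levels that a fixed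
  translation carries out of \<open>F n\<close> (\<open>phase_equivariance_bound\<close>). If the descendants in \<open>I m n\<close> are
  mostly congruent to \<open>g\<close>, and \<open>n\<close> is so large that \<open>F n\<close> is nearly invariant under every element of
  \<open>F m\<close>, the maps for \<open>m\<close> with offset \<open>c\<close> and for \<open>n\<close> with offset \<open>c + g\<close> agree off a small set
  (\<open>phase_disagreement_bound\<close>). Along a sparse subsequence the disagreements are summable, so
  the maps converge in measure (\<open>discrete_limit_in_measure\<close>) to a map that is equivariant almost
  everywhere. Its fibres are permuted transitively by the action, so they have equal measure and the
  map is a factor map (\<open>equivariant_distr\<close>).
\<close>

section \<open>Residues modulo a finite-index subgroup\<close>

abbreviation residue :: "(int ^ 'd) set \<Rightarrow> int ^ 'd \<Rightarrow> (int ^ 'd) set" where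
  "residue G a \<equiv> G #>\<^bsub>lattice_group\<^esub> a"

lemma group_lattice: "group (lattice_group :: (int ^ 'd) monoid)"
  by (rule groupI) (auto simp: lattice_group_def add.assoc intro: left_minus)

lemma residue_conv_image: "residue G a = (\<lambda>h. h + a) ` G"
  by (auto simp: r_coset_def lattice_group_def)

lemma rcosets_lattice_group: "rcosets\<^bsub>lattice_group\<^esub> G = range (residue G)"
  by (auto simp: RCOSETS_def lattice_group_def)

lemma subgroup_lattice_groupD:
  assumes "subgroup G (lattice_group :: (int ^ 'd) monoid)"
  shows "0 \<in> G" "a \<in> G \<Longrightarrow> b \<in> G \<Longrightarrow> a + b \<in> G" "a \<in> G \<Longrightarrow> - a \<in> G"
proof -
  show "0 \<in> G" using subgroup.one_closed[OF assms] by (simp add: lattice_group_def)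
  show "a \<in> G \<Longrightarrow> b \<in> G \<Longrightarrow> a + b \<in> G"
    using subgroup.m_closed[OF assms, of a b] by (simp add: lattice_group_def)
  assume a: "a \<in> G"
  have "inv\<^bsub>lattice_group\<^esub> a = - a"
    by (rule group.inv_equality[OF group_lattice]) (auto simp: lattice_group_def)
  then show "- a \<in> G" using subgroup.m_inv_closed[OF assms a] by simp
qed

lemma residue_eq_iff:
  assumes "finite_index_subgroup G"
  shows "residue G a = residue G b \<longleftrightarrow> a - b \<in> G"
proof -
  have sg: "subgroup G lattice_group" using assms by (simp add: finite_index_subgroup_def)
  note G = subgroup_lattice_groupD[OF sg]
  show ?thesis
  proof
    assume "residue G a = residue G b"
    moreover have "a \<in> residue G a" using G(1) by (force simp: residue_conv_image)
    ultimately show "a - b \<in> G" by (auto simp: residue_conv_image)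
  next
    assume d: "a - b \<in> G"
    have "h + a = (h + (a - b)) + b" "h + b = (h + - (a - b)) + a" for h by auto
    then show "residue G a = residue G b"
      unfolding residue_conv_image using G(2)[OF _ d] G(2)[OF _ G(3)[OF d]] by blast
  qed
qed

lemma odometer_action_residue: "odometer_action v (residue G a) = residue G (a + v)"
  unfolding odometer_action_def residue_conv_image image_image by (simp add: add.assoc)


section \<open>Limits of discrete random variables\<close>

lemma sets_disagreement:
  assumes "countable S" "f \<in> measurable M (count_space S)" "g \<in> measurable M (count_space S)"
  shows "{x \<in> space M. f x \<noteq> g x} \<in> sets M"
proof -
  have "{x \<in> space M. f x \<noteq> g x} = (\<Union>s\<in>S. (f -` {s} \<inter> space M) - (g -` {s} \<inter> space M))"
    using measurable_space[OF assms(2)] by auto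
  also have "\<dots> \<in> sets M"
    using assms by (intro sets.countable_UN' sets.Diff measurable_sets[of _ M "count_space S"]) auto
  finally show ?thesis .
qed

text \<open>
  A point lying in no late disagreement set has a sequence of values that is already constant, so the
  limit is the value from which the sequence stays constant, and its distance to \<open>f k\<close> is bounded by the
  tail of a convergent series. At the remaining points the least index of eventual constancy is an
  arbitrary natural number; these points lie in every tail of disagreement sets, so the bound
  covers them as well.
\<close>

lemma (in prob_space) discrete_limit_in_measure:
  assumes S: "countable S"
    and f: "\<And>k. f k \<in> measurable M (count_space S)"
    and summ: "summable (\<lambda>k. measure M {x \<in> space M. f k x \<noteq> f (Suc k) x})"
  shows "\<exists>g\<in>measurable M (count_space S). (\<lambda>k. measure M {x \<in> space M. f k x \<noteq> g x}) \<longlonglongrightarrow> 0"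
proof -
  define D where "D k = {x \<in> space M. f k x \<noteq> f (Suc k) x}" for k
  define N where "N x = (LEAST n. \<forall>k\<ge>n. f k x = f n x)" for x
  define g where "g x = f (N x) x" for x
  have D: "D k \<in> sets M" for k unfolding D_def by (rule sets_disagreement[OF S f f])
  have [measurable]: "Measurable.pred M (\<lambda>x. f k x = f n x)" for k n
  proof -
    have "{x \<in> space M. f k x = f n x} = space M - {x \<in> space M. f k x \<noteq> f n x}" by auto
    then show ?thesis using sets_disagreement[OF S f f, of k n] by (simp add: pred_def)
  qed
  have [measurable]: "N \<in> measurable M (count_space UNIV)" unfolding N_def by measurable
  have g: "g \<in> measurable M (count_space S)"
    unfolding g_def by (rule measurable_compose_countable[OF f]) measurable
  have sub: "{x \<in> space M. f k x \<noteq> g x} \<subseteq> (\<Union>j. D (j + k))" for k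
  proof
    fix x assume x: "x \<in> {x \<in> space M. f k x \<noteq> g x}"
    show "x \<in> (\<Union>j. D (j + k))"
    proof (rule ccontr)
      assume "x \<notin> (\<Union>j. D (j + k))"
      then have step: "f (Suc (j + k)) x = f (j + k) x" for j using x by (auto simp: D_def)
      have "f (j + k) x = f k x" for j by (induction j) (auto simp: step)
      then have "\<forall>j\<ge>k. f j x = f k x" by (metis le_add_diff_inverse2)
      note Least_le[where P = "\<lambda>n. \<forall>j\<ge>n. f j x = f n x", OF this]
        and LeastI[where P = "\<lambda>n. \<forall>j\<ge>n. f j x = f n x", OF this]
      then have "f k x = f (N x) x" unfolding N_def[symmetric] by blast
      then show False using x by (auto simp: g_def)
    qed
  qed
  let ?a = "\<lambda>j. measure M (D j)"
  have sa: "summable ?a" using summ by (simp add: D_def)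
  have bound: "measure M {x \<in> space M. f k x \<noteq> g x} \<le> suminf ?a - sum ?a {..<k}" for k
  proof -
    have "measure M {x \<in> space M. f k x \<noteq> g x} \<le> measure M (\<Union>j. D (j + k))"
      by (rule finite_measure_mono[OF sub]) (use D in auto)
    also have "\<dots> \<le> (\<Sum>j. ?a (j + k))"
      by (rule finite_measure_subadditive_countably)
        (use D summable_ignore_initial_segment[OF sa, of k] in auto)
    also have "\<dots> = suminf ?a - sum ?a {..<k}" by (rule suminf_minus_initial_segment[OF sa])
    finally show ?thesis .
  qed
  have "(\<lambda>k. suminf ?a - sum ?a {..<k}) \<longlonglongrightarrow> suminf ?a - suminf ?a"
    by (intro tendsto_intros summable_LIMSEQ sa)
  then have "(\<lambda>k. suminf ?a - sum ?a {..<k}) \<longlonglongrightarrow> 0" by simp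
  then have "(\<lambda>k. measure M {x \<in> space M. f k x \<noteq> g x}) \<longlonglongrightarrow> 0"
    by (rule tendsto_sandwich[OF _ _ tendsto_const, rotated 2])
      (use bound in \<open>auto intro!: always_eventually\<close>)
  then show ?thesis using g by blast
qed


section \<open>Measure-preserving lattice actions\<close>

locale lattice_action = prob_space M for M :: "'a measure" +
  fixes T :: "int ^ 'd \<Rightarrow> 'a \<Rightarrow> 'a"
  assumes T_measurable [measurable]: "\<And>v. T v \<in> measurable M M"
    and T_distr: "\<And>v. distr M M (T v) = M"
    and T_add: "\<And>v w x. x \<in> space M \<Longrightarrow> T (v + w) x = T v (T w x)"
    and T_zero: "\<And>x. x \<in> space M \<Longrightarrow> T 0 x = x"
begin

lemma T_space: "x \<in> space M \<Longrightarrow> T v x \<in> space M"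
  using measurable_space[OF T_measurable] .

lemma T_uminus: "x \<in> space M \<Longrightarrow> T (- v) (T v x) = x" "x \<in> space M \<Longrightarrow> T v (T (- v) x) = x"
  using T_add[of x "- v" v] T_add[of x v "- v"] T_zero by auto

lemma mem_image_iff:
  assumes "B \<subseteq> space M"
  shows "x \<in> T v ` B \<longleftrightarrow> x \<in> space M \<and> T (- v) x \<in> B"
proof
  assume "x \<in> T v ` B"
  then show "x \<in> space M \<and> T (- v) x \<in> B" using assms T_uminus(1) T_space by auto
next
  assume "x \<in> space M \<and> T (- v) x \<in> B"
  then show "x \<in> T v ` B" using T_uminus(2)[of x v] by (metis imageI)
qed

lemma image_conv_vimage: "B \<subseteq> space M \<Longrightarrow> T v ` B = T (- v) -` B \<inter> space M"
  unfolding set_eq_iff vimage_eq Int_iff mem_image_iff by blast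

lemma image_subset_space: "B \<subseteq> space M \<Longrightarrow> T v ` B \<subseteq> space M"
  using T_space by auto

lemma image_sets: "B \<in> sets M \<Longrightarrow> T v ` B \<in> sets M"
  by (simp add: image_conv_vimage sets.sets_into_space)

lemma measure_vimage: "B \<in> sets M \<Longrightarrow> measure M (T v -` B \<inter> space M) = measure M B"
  using measure_distr[OF T_measurable, of B v] T_distr[of v] by simp

lemma measure_image: "B \<in> sets M \<Longrightarrow> measure M (T v ` B) = measure M B"
  by (simp add: image_conv_vimage sets.sets_into_space measure_vimage)

lemma image_T_add: "B \<subseteq> space M \<Longrightarrow> T (v + w) ` B = T v ` T w ` B"
  unfolding image_image by (rule image_cong) (auto simp: T_add)

lemma T_zero_image: "B \<subseteq> space M \<Longrightarrow> T 0 ` B = B"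
  using T_zero by (force simp: image_iff)

end

section \<open>Equivariant maps into a finite odometer\<close>

locale odometer_target = lattice_action M T for M :: "'a measure" and T :: "int ^ 'd \<Rightarrow> 'a \<Rightarrow> 'a" +
  fixes G :: "(int ^ 'd) set"
  assumes G: "finite_index_subgroup G"
begin

abbreviation residues :: "(int ^ 'd) set set" where
  "residues \<equiv> range (residue G)"

lemma finite_residues: "finite residues"
  using G by (simp add: finite_index_subgroup_def rcosets_lattice_group)

lemma odometer_measure_eq: "odometer_measure G = uniform_count_measure residues"
  by (simp add: odometer_measure_def rcosets_lattice_group)

lemma measurable_odometer: "measurable M (odometer_measure G) = measurable M (count_space residues)"
  by (rule measurable_cong_sets) (auto simp: odometer_measure_eq sets_uniform_count_measure)

lemma residues_closed: "C \<in> residues \<Longrightarrow> odometer_action v C \<in> residues"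
  by (auto simp: odometer_action_residue)

lemma fibre_sets:
  "\<phi> \<in> measurable M (count_space residues) \<Longrightarrow> {x \<in> space M. \<phi> x = C} \<in> sets M"
proof -
  assume \<phi>: "\<phi> \<in> measurable M (count_space residues)"
  have "{x \<in> space M. \<phi> x = C} = \<phi> -` ({C} \<inter> residues) \<inter> space M"
    using measurable_space[OF \<phi>] by auto
  then show ?thesis using measurable_sets[OF \<phi>, of "{C} \<inter> residues"] by simp
qed

lemma fibre_within_sets:
  assumes "\<phi> \<in> measurable M (count_space residues)" "A \<in> sets M"
  shows "{x \<in> A. \<phi> x = C} \<in> sets M"
proof -
  have "{x \<in> A. \<phi> x = C} = A \<inter> {x \<in> space M. \<phi> x = C}"
    using sets.sets_into_space[OF assms(2)] by auto
  then show ?thesis using assms(2) fibre_sets[OF assms(1)] by simp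
qed

lemma odometer_measurable:
  assumes "\<phi> \<in> measurable M (count_space residues)"
  shows "(\<lambda>x. odometer_action v (\<phi> x)) \<in> measurable M (count_space residues)"
  by (rule measurable_compose[OF assms]) (auto simp: residues_closed)

text \<open>
  Equivariance says that \<open>T v\<close> carries the part of \<open>A\<close> over \<open>c\<close> onto the part of \<open>T v ` A\<close> over
  \<open>c + v\<close>, up to a null set.
\<close>

lemma measure_fibre_shift:
  assumes \<phi>: "\<phi> \<in> measurable M (count_space residues)"
    and eq: "AE x in M. \<phi> (T v x) = odometer_action v (\<phi> x)"
    and A: "A \<in> sets M"
  shows "measure M {x \<in> T v ` A. \<phi> x = residue G (c + v)} = measure M {x \<in> A. \<phi> x = residue G c}"
proof -
  let ?C = "{x \<in> A. \<phi> x = residue G c}"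
  have AS: "A \<subseteq> space M" using A sets.sets_into_space by auto
  note fib = fibre_within_sets[OF \<phi>]
  have "measure M {x \<in> T v ` A. \<phi> x = residue G (c + v)}
      = measure M (T v -` {x \<in> T v ` A. \<phi> x = residue G (c + v)} \<inter> space M)"
    by (rule measure_vimage[symmetric]) (intro fib image_sets A)
  also have "\<dots> = measure M ?C"
  proof (rule finite_measure_eq_AE)
    show "T v -` {x \<in> T v ` A. \<phi> x = residue G (c + v)} \<inter> space M \<in> sets M"
      by (intro measurable_sets[OF T_measurable] fib image_sets A)
    show "?C \<in> sets M" by (rule fib[OF A])
    show "AE x in M. x \<in> T v -` {x \<in> T v ` A. \<phi> x = residue G (c + v)} \<inter> space M \<longleftrightarrow> x \<in> ?C"
      using eq AE_space
    proof eventually_elim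
      case (elim x)
      then obtain a where a: "\<phi> x = residue G a" using measurable_space[OF \<phi>] by fastforce
      have "T v x \<in> T v ` A \<longleftrightarrow> x \<in> A"
        using elim mem_image_iff[OF AS] T_uminus T_space by auto
      moreover have "\<phi> (T v x) = residue G (c + v) \<longleftrightarrow> \<phi> x = residue G c"
        using elim by (simp add: a odometer_action_residue residue_eq_iff[OF G])
      ultimately show ?case using elim by auto
    qed
  qed
  finally show ?thesis .
qed

lemma measure_fibre:
  assumes \<phi>: "\<phi> \<in> measurable M (count_space residues)"
    and eq: "\<And>v. AE x in M. \<phi> (T v x) = odometer_action v (\<phi> x)"
    and C: "C \<in> residues"
  shows "measure M {x \<in> space M. \<phi> x = C} = 1 / card residues"
proof -
  let ?P = "\<lambda>C. measure M {x \<in> space M. \<phi> x = C}"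
  have const: "?P C = ?P (residue G 0)" if C': "C \<in> residues" for C
  proof -
    obtain v where v: "C = residue G v" using C' by blast
    have "T v ` space M = space M" unfolding image_conv_vimage[OF order_refl] using T_space by blast
    then show ?thesis
      using measure_fibre_shift[OF \<phi> eq[of v] sets.top, of 0] by (simp add: v)
  qed
  have U: "(\<Union>C\<in>residues. {x \<in> space M. \<phi> x = C}) = space M"
  proof (intro equalityI subsetI)
    fix x assume x: "x \<in> space M"
    then have "\<phi> x \<in> residues" using measurable_space[OF \<phi> x] by simp
    then show "x \<in> (\<Union>C\<in>residues. {x \<in> space M. \<phi> x = C})" using x by blast
  qed blast
  have "1 = measure M (\<Union>C\<in>residues. {x \<in> space M. \<phi> x = C})"
    unfolding U by (rule prob_space[symmetric])
  also have "\<dots> = (\<Sum>C\<in>residues. ?P C)"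
    by (rule finite_measure_finite_Union)
      (auto simp: disjoint_family_on_def finite_residues intro: fibre_sets[OF \<phi>])
  also have "\<dots> = (\<Sum>C\<in>residues. ?P (residue G 0))" by (rule sum.cong[OF refl const])
  finally have P: "1 = card residues * ?P (residue G 0)" by simp
  then have "card residues \<noteq> 0" by (intro notI) simp
  then show ?thesis using const[OF C] P by (simp add: field_simps)
qed

text \<open>
  Equivariance alone makes the push-forward uniform, so a factor map can be sought among
  the measurable equivariant maps.
\<close>

lemma equivariant_distr:
  assumes \<phi>: "\<phi> \<in> measurable M (count_space residues)"
    and eq: "\<And>v. AE x in M. \<phi> (T v x) = odometer_action v (\<phi> x)"
  shows "distr M (odometer_measure G) \<phi> = odometer_measure G"
proof -
  have \<phi>': "\<phi> \<in> measurable M (odometer_measure G)" using \<phi> by (simp add: measurable_odometer)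
  show ?thesis
  proof (rule measure_eqI_finite[of _ residues])
    fix C assume C: "C \<in> residues"
    have "emeasure (distr M (odometer_measure G) \<phi>) {C} = emeasure M (\<phi> -` {C} \<inter> space M)"
      by (rule emeasure_distr[OF \<phi>']) (use C in \<open>auto simp: odometer_measure_eq sets_uniform_count_measure\<close>)
    also have "\<phi> -` {C} \<inter> space M = {x \<in> space M. \<phi> x = C}" by auto
    also have "emeasure M \<dots> = ennreal (1 / card residues)"
      using measure_fibre[OF \<phi> eq C] by (simp add: emeasure_eq_measure)
    also have "\<dots> = emeasure (odometer_measure G) {C}"
      using C finite_residues
      by (simp add: odometer_measure_eq emeasure_uniform_count_measure ennreal_of_nat_eq_real_of_nat divide_ennreal)
    finally show "emeasure (distr M (odometer_measure G) \<phi>) {C} = emeasure (odometer_measure G) {C}" .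
  qed (use finite_residues in \<open>auto simp: odometer_measure_eq sets_uniform_count_measure\<close>)
qed

lemma factor_iff:
  "G \<in> FF M T \<longleftrightarrow>
    (\<exists>\<phi>\<in>measurable M (count_space residues). \<forall>v. AE x in M. \<phi> (T v x) = odometer_action v (\<phi> x))"
  using G equivariant_distr
  unfolding FF_def factors_onto_def measurable_odometer AE_all_countable mem_Collect_eq by blast

end


section \<open>Stacking towers\<close>

locale stacked_towers = odometer_target M T G
  for M :: "'a measure" and T :: "int ^ 'd \<Rightarrow> 'a \<Rightarrow> 'a" and G :: "(int ^ 'd) set" +
  fixes F :: "nat \<Rightarrow> (int ^ 'd) set" and B :: "nat \<Rightarrow> 'a set"
  assumes folner: "folner_sequence F"
    and zero_mem: "\<And>n. 0 \<in> F n"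
    and towers: "rank_one_towers M T F B"
    and stack: "stacking M T F B"
begin

abbreviation err :: "nat \<Rightarrow> 'a set" where
  "err n \<equiv> error_set M T (F n) (B n)"

abbreviation I :: "nat \<Rightarrow> nat \<Rightarrow> (int ^ 'd) set" where
  "I \<equiv> descendants T F B"

definition escaping :: "int ^ 'd \<Rightarrow> nat \<Rightarrow> (int ^ 'd) set" where
  "escaping v n = {w \<in> F n. w + v \<notin> F n}"

lemma finite_F: "finite (F n)"
  using folner by (simp add: folner_sequence_def shape_def)

lemma card_F_pos: "0 < card (F n)"
  using finite_F zero_mem card_gt_0_iff by blast

lemma B_sets: "B n \<in> sets M" and B_pos: "0 < measure M (B n)"
  and levels_disjoint: "disjoint_family_on (\<lambda>v. T v ` B n) (F n)"
  using towers by (auto simp: rank_one_towers_def is_tower_def)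

lemma B_space: "B n \<subseteq> space M"
  using B_sets sets.sets_into_space by auto

lemma level_sets: "T v ` B n \<in> sets M"
  by (intro image_sets B_sets)

lemma finite_I: "finite (I m n)"
  using finite_F by (simp add: descendants_def)

lemma finite_escaping: "finite (escaping v n)"
  using finite_F by (simp add: escaping_def)

lemma disjoint_subsets_of_levels:
  assumes "J \<subseteq> F n" "\<And>v. v \<in> J \<Longrightarrow> X v \<subseteq> T v ` B n"
  shows "disjoint_family_on X J"
  unfolding disjoint_family_on_def
proof (intro ballI impI)
  fix v w assume "v \<in> J" "w \<in> J" "v \<noteq> w"
  then have "T v ` B n \<inter> T w ` B n = {}" "X v \<subseteq> T v ` B n" "X w \<subseteq> T w ` B n"
    using levels_disjoint[of n] assms by (auto simp: disjoint_family_on_def)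
  then show "X v \<inter> X w = {}" by blast
qed

lemma measure_union_levels:
  assumes "J \<subseteq> F n"
  shows "measure M (\<Union>v\<in>J. T v ` B n) = card J * measure M (B n)"
proof -
  have "measure M (\<Union>v\<in>J. T v ` B n) = (\<Sum>v\<in>J. measure M (T v ` B n))"
    using finite_subset[OF assms finite_F] level_sets disjoint_family_on_mono[OF assms levels_disjoint]
    by (intro finite_measure_finite_Union) auto
  then show ?thesis by (simp add: measure_image B_sets)
qed

lemma measure_B_le: "measure M (B n) \<le> 1 / card (F n)"
  using measure_union_levels[of "F n" n] prob_le_1[of "\<Union>v\<in>F n. T v ` B n"] card_F_pos[of n]
  by (simp add: field_simps)

lemma err_sets: "err n \<in> sets M"
  unfolding error_set_def using finite_F level_sets by (intro sets.Diff sets.finite_UN) auto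

lemma levels_approximate:
  assumes "A \<in> sets M"
  shows "\<exists>L. (\<forall>n. union_of_levels T (F n) (B n) (L n)) \<and>
    (\<lambda>n. measure M (sym_diff (L n) A)) \<longlonglongrightarrow> 0"
  using towers assms by (simp add: rank_one_towers_def)

lemma err_tendsto_0: "(\<lambda>n. measure M (err n)) \<longlonglongrightarrow> 0"
proof -
  obtain L where "(\<forall>n. union_of_levels T (F n) (B n) (L n)) \<and>
      (\<lambda>n. measure M (sym_diff (L n) (space M))) \<longlonglongrightarrow> 0"
    using levels_approximate[OF sets.top] by (rule exE)
  then have L: "\<And>n. union_of_levels T (F n) (B n) (L n)"
    and lim: "(\<lambda>n. measure M (sym_diff (L n) (space M))) \<longlonglongrightarrow> 0"
    by simp_all
  have le: "measure M (err n) \<le> measure M (sym_diff (L n) (space M))" for n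
  proof -
    obtain J where J: "J \<subseteq> F n" "L n = (\<Union>v\<in>J. T v ` B n)"
      using L[of n] by (auto simp: union_of_levels_def)
    have "L n \<in> sets M"
      unfolding J(2) using level_sets finite_subset[OF J(1) finite_F] by (intro sets.finite_UN) auto
    moreover have "err n \<subseteq> sym_diff (L n) (space M)" using J by (auto simp: error_set_def)
    ultimately show ?thesis by (intro finite_measure_mono) auto
  qed
  show ?thesis
    by (rule tendsto_sandwich[OF _ _ tendsto_const lim]) (use le in \<open>auto intro!: always_eventually\<close>)
qed

lemma escaping_tendsto_0: "(\<lambda>n. card (escaping v n) / card (F n)) \<longlonglongrightarrow> 0"
proof -
  have lim: "(\<lambda>n. real (card (sym_diff (F n) ((\<lambda>u. u + v) ` F n))) / real (card (F n))) \<longlonglongrightarrow> 0"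
    using folner by (simp add: folner_sequence_def)
  have le: "card (escaping v n) \<le> card (sym_diff (F n) ((\<lambda>u. u + v) ` F n))" for n
    by (rule card_inj_on_le[of "\<lambda>u. u + v"]) (use finite_F in \<open>auto simp: escaping_def inj_on_def\<close>)
  show ?thesis
    by (rule tendsto_sandwich[OF _ _ tendsto_const lim])
      (use le in \<open>auto intro!: always_eventually divide_right_mono\<close>)
qed

lemma union_of_levels_refine:
  assumes "m \<le> n" "v \<in> F m"
  shows "union_of_levels T (F n) (B n) (T v ` B m)"
  using assms(1)
proof (induction n rule: dec_induct)
  case base
  have "T v ` B m = (\<Union>w\<in>{v}. T w ` B m)" by simp
  then show ?case using assms(2) unfolding union_of_levels_def by (intro exI[of _ "{v}"]) simp
next
  case (step n)
  then obtain J where J: "J \<subseteq> F n" "T v ` B m = (\<Union>w\<in>J. T w ` B n)"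
    by (auto simp: union_of_levels_def)
  have "\<exists>K\<subseteq>F (Suc n). T w ` B n = (\<Union>u\<in>K. T u ` B (Suc n))" if "w \<in> J" for w
    using conjunct1[OF stack[unfolded stacking_def], rule_format, of w n] that J(1)
    by (auto simp: union_of_levels_def)
  then obtain K where K: "\<And>w. w \<in> J \<Longrightarrow> K w \<subseteq> F (Suc n)"
      "\<And>w. w \<in> J \<Longrightarrow> T w ` B n = (\<Union>u\<in>K w. T u ` B (Suc n))"
    by metis
  have "T v ` B m = (\<Union>w\<in>J. \<Union>u\<in>K w. T u ` B (Suc n))"
    unfolding J(2) by (rule SUP_cong[OF refl K(2)])
  also have "\<dots> = (\<Union>u\<in>(\<Union>w\<in>J. K w). T u ` B (Suc n))" by blast
  finally show ?case
    unfolding union_of_levels_def using K(1) by (intro exI[of _ "\<Union>w\<in>J. K w"]) blast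
qed

lemma base_eq_descendants:
  assumes "m \<le> n"
  shows "B m = (\<Union>i\<in>I m n. T i ` B n)"
proof -
  obtain J where J: "J \<subseteq> F n" "B m = (\<Union>w\<in>J. T w ` B n)"
    using union_of_levels_refine[OF assms zero_mem] T_zero_image[OF B_space]
    by (auto simp: union_of_levels_def)
  then have "J \<subseteq> I m n" by (auto simp: descendants_def)
  then have "B m \<subseteq> (\<Union>i\<in>I m n. T i ` B n)" unfolding J(2) by (rule UN_mono) simp
  moreover have "(\<Union>i\<in>I m n. T i ` B n) \<subseteq> B m" by (rule UN_least) (simp add: descendants_def)
  ultimately show ?thesis by (rule equalityI)
qed

lemma measure_base:
  assumes "m \<le> n"
  shows "measure M (B m) = card (I m n) * measure M (B n)"
  by (subst base_eq_descendants[OF assms], rule measure_union_levels) (auto simp: descendants_def)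

lemma card_I_pos: "m \<le> n \<Longrightarrow> 0 < card (I m n)"
  using measure_base[of m n] B_pos[of m] by (metis gr0I mult_zero_left of_nat_0 less_irrefl)

section \<open>A factor onto the odometer forces congruent descendants\<close>

text \<open>
  Let \<open>A\<close> be the fibre over \<open>0\<close> and \<open>L m\<close> a union of levels approximating it. The level
  \<open>T v ` B m\<close> meets \<open>A\<close> in as much measure as \<open>B m\<close> meets the fibre over \<open>- v\<close>. If \<open>B m\<close> met every
  fibre in at most the proportion \<open>1 - \<epsilon>\<close>, so would every level forming \<open>L m\<close>, and \<open>L m\<close> would differ
  from \<open>A\<close> by roughly \<open>\<epsilon>\<close> times the measure of \<open>A\<close>, a fixed positive amount.
\<close>

lemma base_in_fibre:
  assumes \<phi>: "\<phi> \<in> measurable M (count_space residues)"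
    and eq: "\<And>v. AE x in M. \<phi> (T v x) = odometer_action v (\<phi> x)"
    and pos: "0 < measure M {x \<in> space M. \<phi> x = residue G 0}"
    and eps: "0 < \<epsilon>" "\<epsilon> < 1"
  shows "\<forall>\<^sub>F m in sequentially. \<exists>c. (1 - \<epsilon>) * measure M (B m) < measure M {x \<in> B m. \<phi> x = residue G c}"
proof -
  define A where "A = {x \<in> space M. \<phi> x = residue G 0}"
  have A: "A \<in> sets M" unfolding A_def by (rule fibre_sets[OF \<phi>])
  obtain L where "(\<forall>n. union_of_levels T (F n) (B n) (L n)) \<and>
      (\<lambda>n. measure M (sym_diff (L n) A)) \<longlonglongrightarrow> 0"
    using levels_approximate[OF A] by (rule exE)
  then have L: "\<And>n. union_of_levels T (F n) (B n) (L n)"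
    and lim: "(\<lambda>n. measure M (sym_diff (L n) A)) \<longlonglongrightarrow> 0"
    by simp_all
  have "\<forall>\<^sub>F m in sequentially. measure M (sym_diff (L m) A) < \<epsilon> * measure M A / 2"
    by (rule order_tendstoD(2)[OF lim]) (use eps pos in \<open>simp add: A_def\<close>)
  then show ?thesis
  proof eventually_elim
    case (elim m)
    let ?\<delta> = "measure M (sym_diff (L m) A)"
    obtain J where J: "J \<subseteq> F m" "L m = (\<Union>v\<in>J. T v ` B m)"
      using L[of m] by (auto simp: union_of_levels_def)
    have fJ: "finite J" using finite_subset[OF J(1) finite_F] .
    have Lm: "L m \<in> sets M"
      unfolding J(2) using level_sets fJ by (intro sets.finite_UN) auto
    show ?case
    proof (rule ccontr)
      assume "\<not> ?case"
      then have small: "measure M {x \<in> B m. \<phi> x = residue G c} \<le> (1 - \<epsilon>) * measure M (B m)" for c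
        by (meson not_le)
      have "measure M (L m \<inter> A) = measure M (\<Union>v\<in>J. T v ` B m \<inter> A)"
        by (simp add: J(2))
      also have "\<dots> = (\<Sum>v\<in>J. measure M (T v ` B m \<inter> A))"
        using fJ level_sets A
        by (intro finite_measure_finite_Union disjoint_subsets_of_levels[OF J(1)]) auto
      also have "\<dots> = (\<Sum>v\<in>J. measure M {x \<in> B m. \<phi> x = residue G (- v)})"
      proof (rule sum.cong[OF refl])
        fix v
        have "T v ` B m \<inter> A = {x \<in> T v ` B m. \<phi> x = residue G (- v + v)}"
          using image_subset_space[OF B_space] by (auto simp: A_def)
        then show "measure M (T v ` B m \<inter> A) = measure M {x \<in> B m. \<phi> x = residue G (- v)}"
          using measure_fibre_shift[OF \<phi> eq B_sets, of v m "- v"] by simp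
      qed
      also have "\<dots> \<le> (\<Sum>v\<in>J. (1 - \<epsilon>) * measure M (B m))" by (rule sum_mono[OF small])
      also have "\<dots> = (1 - \<epsilon>) * measure M (L m)" by (simp add: J measure_union_levels)
      finally have 1: "measure M (L m \<inter> A) \<le> (1 - \<epsilon>) * measure M (L m)" .
      have "measure M (L m) \<le> measure M ((L m \<inter> A) \<union> sym_diff (L m) A)"
        using Lm A by (intro finite_measure_mono) auto
      also have "\<dots> \<le> measure M (L m \<inter> A) + ?\<delta>" using Lm A by (intro measure_Un_le) auto
      finally have 2: "measure M (L m) \<le> measure M (L m \<inter> A) + ?\<delta>" .
      have "measure M A \<le> measure M ((L m \<inter> A) \<union> sym_diff (L m) A)"
        using Lm A by (intro finite_measure_mono) auto
      also have "\<dots> \<le> measure M (L m \<inter> A) + ?\<delta>" using Lm A by (intro measure_Un_le) auto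
      finally have 3: "measure M A \<le> measure M (L m \<inter> A) + ?\<delta>" .
      have "measure M (L m \<inter> A) \<le> (1 - \<epsilon>) * (measure M (L m \<inter> A) + ?\<delta>)"
        using 1 mult_left_mono[OF 2, of "1 - \<epsilon>"] eps by linarith
      then have "\<epsilon> * (measure M (L m \<inter> A) + ?\<delta>) \<le> ?\<delta>" by (simp add: algebra_simps)
      moreover have "\<epsilon> * measure M A \<le> \<epsilon> * (measure M (L m \<inter> A) + ?\<delta>)"
        using 3 eps by (intro mult_left_mono) auto
      moreover have "0 < \<epsilon> * measure M A" using eps pos by (simp add: A_def)
      ultimately show False using elim by linarith
    qed
  qed
qed

text \<open>
  For a descendant \<open>i\<close> incongruent to \<open>a - c\<close>, the part of \<open>T i ` B n\<close> over \<open>c + i\<close> is disjoint from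
  the part of \<open>B m\<close> over \<open>a\<close>, while both lie in \<open>B m\<close>.
\<close>

lemma incongruent_descendants_bound:
  assumes \<phi>: "\<phi> \<in> measurable M (count_space residues)"
    and eq: "\<And>v. AE x in M. \<phi> (T v x) = odometer_action v (\<phi> x)"
    and mn: "m \<le> n"
  shows "measure M {x \<in> B m. \<phi> x = residue G a}
      + card {i \<in> I m n. i - (a - c) \<notin> G} * measure M {x \<in> B n. \<phi> x = residue G c} \<le> measure M (B m)"
proof -
  let ?bad = "{i \<in> I m n. i - (a - c) \<notin> G}"
  let ?U = "\<Union>i\<in>?bad. {x \<in> T i ` B n. \<phi> x = residue G (c + i)}"
  let ?V = "{x \<in> B m. \<phi> x = residue G a}"
  note fib = fibre_within_sets[OF \<phi>]
  have bad: "?bad \<subseteq> F n" by (auto simp: descendants_def)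
  have fbad: "finite ?bad" using finite_I by simp
  have Us: "?U \<in> sets M" using fbad fib level_sets by (intro sets.finite_UN) auto
  have "measure M ?U = (\<Sum>i\<in>?bad. measure M {x \<in> T i ` B n. \<phi> x = residue G (c + i)})"
    using fbad fib level_sets
    by (intro finite_measure_finite_Union disjoint_subsets_of_levels[OF bad]) auto
  also have "\<dots> = card ?bad * measure M {x \<in> B n. \<phi> x = residue G c}"
    by (simp add: measure_fibre_shift[OF \<phi> eq B_sets])
  finally have U: "measure M ?U = card ?bad * measure M {x \<in> B n. \<phi> x = residue G c}" .
  have "?V \<inter> ?U = {}"
  proof (rule ccontr)
    assume "?V \<inter> ?U \<noteq> {}"
    then obtain i where "i - (a - c) \<notin> G" "residue G (c + i) = residue G a" by auto
    then show False by (simp add: residue_eq_iff[OF G] algebra_simps)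
  qed
  then have "measure M ?V + measure M ?U = measure M (?V \<union> ?U)"
    using fib[OF B_sets] Us by (intro finite_measure_Union[symmetric]) auto
  also have "\<dots> \<le> measure M (B m)"
    using B_sets base_eq_descendants[OF mn] by (intro finite_measure_mono) blast+
  finally show ?thesis by (simp add: U)
qed

lemma factor_imp_congruent_descendants:
  assumes "G \<in> FF M T" and e: "0 < \<epsilon>"
  shows "\<exists>N. \<forall>m n. N \<le> m \<longrightarrow> m \<le> n \<longrightarrow>
      (\<exists>g. real (card {i \<in> I m n. i - g \<notin> G}) / real (card (I m n)) < \<epsilon>)"
proof -
  obtain \<phi> where \<phi>: "\<phi> \<in> measurable M (count_space residues)"
      and eq': "\<forall>v. AE x in M. \<phi> (T v x) = odometer_action v (\<phi> x)"
    using assms(1)[unfolded factor_iff] by (rule bexE)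
  note eq = spec[OF eq']
  have pos: "0 < measure M {x \<in> space M. \<phi> x = residue G 0}"
    using measure_fibre[OF \<phi> eq] finite_residues by (simp add: card_gt_0_iff)
  \<comment> \<open>The bound obtained for the proportion of incongruent descendants is \<open>\<eta> / (1 - \<eta>)\<close>, which this
    choice turns into \<open>\<epsilon>\<close>.\<close>
  define \<eta> where "\<eta> = \<epsilon> / (1 + \<epsilon>)"
  have eta: "0 < \<eta>" "\<eta> < 1" and eta_eq: "\<eta> = \<epsilon> * (1 - \<eta>)"
    using e by (auto simp: \<eta>_def field_simps)
  obtain N where N: "\<And>m. N \<le> m \<Longrightarrow>
      \<exists>c. (1 - \<eta>) * measure M (B m) < measure M {x \<in> B m. \<phi> x = residue G c}"
    using base_in_fibre[OF \<phi> eq pos eta] by (auto simp: eventually_sequentially)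
  have "\<exists>g. real (card {i \<in> I m n. i - g \<notin> G}) / real (card (I m n)) < \<epsilon>"
    if Nm: "N \<le> m" and mn: "m \<le> n" for m n
  proof -
    obtain a where a: "(1 - \<eta>) * measure M (B m) < measure M {x \<in> B m. \<phi> x = residue G a}"
      using N[OF Nm] by auto
    obtain c where c: "(1 - \<eta>) * measure M (B n) < measure M {x \<in> B n. \<phi> x = residue G c}"
      using N[of n] Nm mn by auto
    let ?b = "real (card {i \<in> I m n. i - (a - c) \<notin> G})"
    have "?b * ((1 - \<eta>) * measure M (B n)) \<le> ?b * measure M {x \<in> B n. \<phi> x = residue G c}"
      using c by (intro mult_left_mono) auto
    also have "\<dots> < \<eta> * measure M (B m)"
      using incongruent_descendants_bound[OF \<phi> eq mn, of a c] a by (simp add: algebra_simps)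
    also have "\<dots> = \<epsilon> * card (I m n) * ((1 - \<eta>) * measure M (B n))"
      by (subst eta_eq) (simp add: measure_base[OF mn])
    finally have "?b < \<epsilon> * card (I m n)"
      by (rule mult_right_less_imp_less) (use eta in simp)
    then have "?b / card (I m n) < \<epsilon>" using card_I_pos[OF mn] by (simp add: field_simps)
    then show ?thesis by blast
  qed
  then show ?thesis by blast
qed

section \<open>Congruent descendants produce a factor map\<close>

definition level_index :: "nat \<Rightarrow> 'a \<Rightarrow> int ^ 'd" where
  "level_index n x = (SOME v. v \<in> F n \<and> x \<in> T v ` B n)"

text \<open>
  The offset \<open>c\<close> records the residue assigned to the base, up to sign; it lets the maps for
  different towers be aligned with each other.
\<close>

definition phase :: "nat \<Rightarrow> int ^ 'd \<Rightarrow> 'a \<Rightarrow> (int ^ 'd) set" where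
  "phase n c x = residue G (level_index n x - c)"

lemma level_index_eq:
  assumes "v \<in> F n" "x \<in> T v ` B n"
  shows "level_index n x = v"
  unfolding level_index_def
proof (rule some_equality)
  show "v \<in> F n \<and> x \<in> T v ` B n" using assms by simp
  show "w = v" if "w \<in> F n \<and> x \<in> T w ` B n" for w
    using that assms levels_disjoint[of n] by (auto simp: disjoint_family_on_def)
qed

text \<open>
  On the error set the defining property of \<open>level_index\<close> is unsatisfiable, so all points of the error
  set receive one and the same unspecified value.
\<close>

lemma level_index_measurable: "level_index n \<in> measurable M (count_space UNIV)"
proof -
  have ex: "level_index n x = (SOME v. False)" if "x \<in> err n" for x
  proof -
    have "(\<lambda>v. v \<in> F n \<and> x \<in> T v ` B n) = (\<lambda>v. False)" using that by (auto simp: error_set_def)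
    then show ?thesis unfolding level_index_def by (rule arg_cong)
  qed
  have "level_index n -` {a} \<inter> space M \<in> sets M" for a
  proof -
    have "level_index n -` {a} \<inter> space M =
        (if a \<in> F n then T a ` B n else {}) \<union> (if a = (SOME v. False) then err n else {})"
      (is "?l = ?r")
    proof (intro equalityI subsetI)
      fix x assume x: "x \<in> ?l"
      show "x \<in> ?r"
      proof (cases "x \<in> err n")
        case True
        then show ?thesis using ex x by auto
      next
        case False
        then obtain v where "v \<in> F n" "x \<in> T v ` B n" using x by (auto simp: error_set_def)
        then show ?thesis using level_index_eq x by auto
      qed
    next
      fix x assume "x \<in> ?r"
      then consider "a \<in> F n" "x \<in> T a ` B n" | "a = (SOME v. False)" "x \<in> err n"
        by (auto split: if_splits)
      then show "x \<in> ?l"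
      proof cases
        case 1
        then show ?thesis using level_index_eq sets.sets_into_space[OF level_sets] by blast
      next
        case 2
        then show ?thesis using ex by (auto simp: error_set_def)
      qed
    qed
    then show ?thesis using level_sets err_sets by auto
  qed
  then show ?thesis by (subst measurable_count_space_eq2_countable) auto
qed

lemma phase_measurable: "phase n c \<in> measurable M (count_space residues)"
  unfolding phase_def by (rule measurable_compose[OF level_index_measurable]) auto

lemma measure_union_translates_le:
  assumes "finite A" "\<And>v. v \<in> A \<Longrightarrow> finite (K v)"
  shows "measure M (\<Union>v\<in>A. \<Union>i\<in>K v. T (v + i) ` B n) \<le> (\<Sum>v\<in>A. card (K v) * measure M (B n))"
proof -
  have "measure M (\<Union>v\<in>A. \<Union>i\<in>K v. T (v + i) ` B n) \<le> (\<Sum>v\<in>A. measure M (\<Union>i\<in>K v. T (v + i) ` B n))"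
    using assms level_sets by (intro measure_UNION_le sets.finite_UN) auto
  also have "\<dots> \<le> (\<Sum>v\<in>A. \<Sum>i\<in>K v. measure M (T (v + i) ` B n))"
    using assms level_sets by (intro sum_mono measure_UNION_le) auto
  finally show ?thesis by (simp add: measure_image B_sets)
qed

text \<open>
  A point of \<open>T v ` B m\<close> lies in \<open>T (v + i) ` B n\<close> for a descendant \<open>i\<close>. If \<open>v + i\<close> belongs to \<open>F n\<close>, it is
  the position of the point in the \<open>n\<close>-th tower, and the two phases differ by the residue of \<open>i - g\<close>.
  Stacking does not guarantee \<open>v + i \<in> F n\<close>: the pieces of \<open>T v ` B m\<close> may sit in the \<open>n\<close>-th tower at other
  positions. The last summand accounts for these exceptional points.
\<close>

lemma phase_disagreement_bound:
  assumes mn: "m \<le> n"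
  shows "measure M {x \<in> space M. phase m c x \<noteq> phase n (c + g) x}
    \<le> measure M (err m) + card {i \<in> I m n. i - g \<notin> G} / card (I m n)
      + (\<Sum>v\<in>F m. card (escaping v n) / card (F n))"
proof -
  let ?bad = "{i \<in> I m n. i - g \<notin> G}"
  let ?X = "\<Union>v\<in>F m. \<Union>i\<in>?bad. T (v + i) ` B n"
  let ?Y = "\<Union>v\<in>F m. \<Union>i\<in>escaping v n. T (v + i) ` B n"
  have fbad: "finite ?bad" using finite_I by simp
  have sub: "{x \<in> space M. phase m c x \<noteq> phase n (c + g) x} \<subseteq> (err m \<union> ?X) \<union> ?Y"
  proof
    fix x assume x: "x \<in> {x \<in> space M. phase m c x \<noteq> phase n (c + g) x}"
    show "x \<in> (err m \<union> ?X) \<union> ?Y"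
    proof (rule ccontr)
      assume no: "x \<notin> (err m \<union> ?X) \<union> ?Y"
      then obtain v where v: "v \<in> F m" "x \<in> T v ` B m" using x by (auto simp: error_set_def)
      then obtain i where i: "i \<in> I m n" "x \<in> T v ` T i ` B n"
        using base_eq_descendants[OF mn] by auto
      have xi: "x \<in> T (v + i) ` B n" using i(2) image_T_add[OF B_space] by auto
      have iG: "i - g \<in> G" using no xi v i by auto
      have "i \<in> F n" using i by (simp add: descendants_def)
      moreover have "i \<notin> escaping v n" using no xi v(1) by blast
      ultimately have "v + i \<in> F n" by (simp add: escaping_def add.commute)
      then have "level_index n x = v + i" "level_index m x = v"
        using xi v by (auto intro: level_index_eq)
      then have "phase n (c + g) x = phase m c x"
        using iG by (simp add: phase_def residue_eq_iff[OF G] algebra_simps)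
      then show False using x by simp
    qed
  qed
  have sets: "?X \<in> sets M" "?Y \<in> sets M"
    using finite_F fbad finite_escaping level_sets by (auto intro!: sets.finite_UN)
  \<comment> \<open>Bad descendants occupy the same proportion of every level of the \<open>m\<close>-th tower as of its base,
    and the levels together have measure at most 1.\<close>
  have "measure M ?X \<le> card (F m) * (card ?bad * measure M (B n))"
    using measure_union_translates_le[OF finite_F fbad, of n m] by simp
  also have "\<dots> = (card ?bad / card (I m n)) * (card (F m) * measure M (B m))"
    using card_I_pos[OF mn] by (simp add: measure_base[OF mn])
  also have "\<dots> \<le> card ?bad / card (I m n) * 1"
    using measure_B_le[of m] card_F_pos[of m] by (intro mult_left_mono) (auto simp: field_simps)
  finally have X: "measure M ?X \<le> card ?bad / card (I m n)" by simp
  have "measure M ?Y \<le> (\<Sum>v\<in>F m. card (escaping v n) * measure M (B n))"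
    by (rule measure_union_translates_le[OF finite_F finite_escaping])
  also have "\<dots> \<le> (\<Sum>v\<in>F m. card (escaping v n) * (1 / card (F n)))"
    by (intro sum_mono mult_left_mono measure_B_le) auto
  finally have Y: "measure M ?Y \<le> (\<Sum>v\<in>F m. card (escaping v n) / card (F n))" by simp
  have "measure M {x \<in> space M. phase m c x \<noteq> phase n (c + g) x} \<le> measure M ((err m \<union> ?X) \<union> ?Y)"
    using sub sets err_sets by (intro finite_measure_mono) auto
  also have "\<dots> \<le> measure M (err m \<union> ?X) + measure M ?Y"
    using sets err_sets by (intro measure_Un_le) auto
  also have "\<dots> \<le> (measure M (err m) + measure M ?X) + measure M ?Y"
    using sets err_sets by (intro add_right_mono measure_Un_le) auto
  finally show ?thesis using X Y by linarith
qed

lemma phase_equivariance_bound: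
  "measure M {x \<in> space M. phase n c (T v x) \<noteq> odometer_action v (phase n c x)}
    \<le> measure M (err n) + card (escaping v n) / card (F n)"
proof -
  let ?Y = "\<Union>w\<in>escaping v n. T w ` B n"
  have sub: "{x \<in> space M. phase n c (T v x) \<noteq> odometer_action v (phase n c x)} \<subseteq> err n \<union> ?Y"
  proof
    fix x assume x: "x \<in> {x \<in> space M. phase n c (T v x) \<noteq> odometer_action v (phase n c x)}"
    show "x \<in> err n \<union> ?Y"
    proof (rule ccontr)
      assume no: "x \<notin> err n \<union> ?Y"
      then obtain w where w: "w \<in> F n" "x \<in> T w ` B n" using x by (auto simp: error_set_def)
      then have "w + v \<in> F n" using no by (auto simp: escaping_def)
      moreover have "T v x \<in> T (w + v) ` B n"
        using w(2) image_T_add[OF B_space, of v w n] by (auto simp: add.commute)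
      ultimately have "level_index n (T v x) = w + v" "level_index n x = w"
        using w by (auto intro: level_index_eq)
      then have "phase n c (T v x) = odometer_action v (phase n c x)"
        by (simp add: phase_def odometer_action_residue algebra_simps)
      then show False using x by simp
    qed
  qed
  have Ys: "?Y \<in> sets M" using finite_escaping level_sets by (intro sets.finite_UN) auto
  have "measure M ?Y = card (escaping v n) * measure M (B n)"
    by (rule measure_union_levels) (auto simp: escaping_def)
  also have "\<dots> \<le> card (escaping v n) * (1 / card (F n))"
    by (intro mult_left_mono measure_B_le) auto
  finally have Y: "measure M ?Y \<le> card (escaping v n) / card (F n)" by simp
  have "measure M {x \<in> space M. phase n c (T v x) \<noteq> odometer_action v (phase n c x)} \<le> measure M (err n \<union> ?Y)"
    using sub Ys err_sets by (intro finite_measure_mono) auto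
  also have "\<dots> \<le> measure M (err n) + measure M ?Y"
    using Ys err_sets by (intro measure_Un_le) auto
  finally show ?thesis using Y by linarith
qed

lemma congruent_descendants_imp_factor:
  assumes congr: "\<And>\<epsilon>. 0 < \<epsilon> \<Longrightarrow> \<exists>N. \<forall>m n. N \<le> m \<longrightarrow> m \<le> n \<longrightarrow>
      (\<exists>g. real (card {i \<in> I m n. i - g \<notin> G}) / real (card (I m n)) < \<epsilon>)"
  shows "G \<in> FF M T"
proof -
  let ?ratio = "\<lambda>m n g. real (card {i \<in> I m n. i - g \<notin> G}) / real (card (I m n))"
  \<comment> \<open>Invariance of \<open>F n\<close> under the elements of \<open>F m\<close> can be demanded only after \<open>m\<close> is
    known, so the subsequence is built by dependent choice.\<close>
  let ?P = "\<lambda>k m. measure M (err m) < (1/2) ^ k \<and> (\<forall>n\<ge>m. \<exists>g. ?ratio m n g < (1/2) ^ k)"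
  let ?Q = "\<lambda>k m n. m < n \<and> (\<Sum>v\<in>F m. card (escaping v n) / card (F n)) < (1/2 :: real) ^ k"
  have evP: "\<forall>\<^sub>F m in sequentially. ?P k m" for k
  proof (rule eventually_conj)
    show "\<forall>\<^sub>F m in sequentially. measure M (err m) < (1/2) ^ k"
      by (rule order_tendstoD(2)[OF err_tendsto_0]) simp
    show "\<forall>\<^sub>F m in sequentially. \<forall>n\<ge>m. \<exists>g. ?ratio m n g < (1/2) ^ k"
      using congr[of "(1/2) ^ k"] unfolding eventually_sequentially by fastforce
  qed
  have evQ: "\<forall>\<^sub>F n in sequentially. ?Q k m n" for k m
  proof (rule eventually_conj[OF eventually_gt_at_top])
    have "(\<lambda>n. \<Sum>v\<in>F m. card (escaping v n) / card (F n)) \<longlonglongrightarrow> (\<Sum>v\<in>F m. 0)"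
      by (intro tendsto_sum escaping_tendsto_0)
    then show "\<forall>\<^sub>F n in sequentially. (\<Sum>v\<in>F m. card (escaping v n) / card (F n)) < (1/2 :: real) ^ k"
      by (rule order_tendstoD(2)) simp
  qed
  have "\<exists>p. \<forall>k. ?P k (p k) \<and> ?Q k (p k) (p (Suc k))"
  proof (rule dependent_nat_choice)
    show "\<exists>m. ?P 0 m" using eventually_happens'[OF sequentially_bot evP] .
    show "\<exists>n. ?P (Suc k) n \<and> ?Q k m n" for m k
      using eventually_happens'[OF sequentially_bot eventually_conj[OF evP evQ]] .
  qed
  then obtain p where P: "\<And>k. ?P k (p k)" and Q: "\<And>k. ?Q k (p k) (p (Suc k))" by blast
  have p_le: "p k \<le> p (Suc k)" for k using Q[of k] by simp
  have "\<forall>k. \<exists>g. ?ratio (p k) (p (Suc k)) g < (1/2) ^ k" using P p_le by blast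
  then have "\<exists>g. \<forall>k. ?ratio (p k) (p (Suc k)) (g k) < (1/2) ^ k" by (rule choice)
  then obtain g where g: "\<forall>k. ?ratio (p k) (p (Suc k)) (g k) < (1/2) ^ k" by (rule exE)
  \<comment> \<open>From \<open>p k\<close> to \<open>p (k + 1)\<close> most positions shift by \<open>g k\<close> modulo \<open>G\<close>, so the offsets accumulate
    these shifts.\<close>
  define c where "c k = (\<Sum>j<k. g j)" for k
  define f where "f k = phase (p k) (c k)" for k
  have f: "f k \<in> measurable M (count_space residues)" for k
    unfolding f_def by (rule phase_measurable)
  have "summable (\<lambda>k. measure M {x \<in> space M. f k x \<noteq> f (Suc k) x})"
  proof (rule summable_comparison_test')
    show "summable (\<lambda>k. 3 * (1/2 :: real) ^ k)" by (intro summable_mult summable_geometric) simp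
    show "norm (measure M {x \<in> space M. f k x \<noteq> f (Suc k) x}) \<le> 3 * (1/2) ^ k" for k
    proof -
      have "c (Suc k) = c k + g k" by (simp add: c_def)
      then have "measure M {x \<in> space M. f k x \<noteq> f (Suc k) x}
          \<le> measure M (err (p k)) + ?ratio (p k) (p (Suc k)) (g k)
            + (\<Sum>v\<in>F (p k). card (escaping v (p (Suc k))) / card (F (p (Suc k))))"
        using phase_disagreement_bound[OF p_le, of k "c k" "g k"] unfolding f_def by simp
      then show ?thesis
        using conjunct1[OF P[of k]] conjunct2[OF Q[of k]] spec[OF g, of k]
        unfolding real_norm_def abs_of_nonneg[OF measure_nonneg] by linarith
    qed
  qed
  from discrete_limit_in_measure[OF countable_finite[OF finite_residues] f this]
  obtain \<phi> where \<phi>: "\<phi> \<in> measurable M (count_space residues)"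
      and lim: "(\<lambda>k. measure M {x \<in> space M. f k x \<noteq> \<phi> x}) \<longlonglongrightarrow> 0"
    by (rule bexE)
  have p_lim: "filterlim p sequentially sequentially"
    by (rule filterlim_subseq) (simp add: strict_mono_Suc_iff Q)
  \<comment> \<open>A point violating equivariance of \<open>\<phi>\<close> violates that of \<open>f k\<close>, or \<open>f k\<close> and \<open>\<phi>\<close> differ at the
    point or at its translate; all three sets shrink to measure 0.\<close>
  have eq: "AE x in M. \<phi> (T v x) = odometer_action v (\<phi> x)" for v
  proof -
    note dis = sets_disagreement[OF countable_finite[OF finite_residues]]
    note Tm = measurable_compose[OF T_measurable]
    let ?E = "{x \<in> space M. \<phi> (T v x) \<noteq> odometer_action v (\<phi> x)}"
    let ?D = "\<lambda>k. {x \<in> space M. f k x \<noteq> \<phi> x}"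
    let ?V = "\<lambda>k. T v -` ?D k \<inter> space M"
    let ?W = "\<lambda>k. {x \<in> space M. f k (T v x) \<noteq> odometer_action v (f k x)}"
    have E: "?E \<in> sets M" by (rule dis[OF Tm[OF \<phi>] odometer_measurable[OF \<phi>]])
    have D: "?D k \<in> sets M" for k by (rule dis[OF f \<phi>])
    have V: "?V k \<in> sets M" for k by (rule measurable_sets[OF T_measurable D])
    have W: "?W k \<in> sets M" for k by (rule dis[OF Tm[OF f] odometer_measurable[OF f]])
    have bound: "measure M ?E \<le> (measure M (?D k) + measure M (?D k))
        + (measure M (err (p k)) + card (escaping v (p k)) / card (F (p k)))" for k
    proof -
      have "measure M ?E \<le> measure M ((?D k \<union> ?V k) \<union> ?W k)"
        using D V W T_space by (intro finite_measure_mono sets.Un) auto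
      also have "\<dots> \<le> measure M (?D k \<union> ?V k) + measure M (?W k)"
        using D V W by (intro measure_Un_le sets.Un)
      also have "\<dots> \<le> (measure M (?D k) + measure M (?V k)) + measure M (?W k)"
        using D V by (intro add_right_mono measure_Un_le)
      finally show ?thesis
        using measure_vimage[OF D, of v k] phase_equivariance_bound[of "p k" "c k" v]
        unfolding f_def by linarith
    qed
    have "(\<lambda>k. (measure M (?D k) + measure M (?D k))
        + (measure M (err (p k)) + card (escaping v (p k)) / card (F (p k)))) \<longlonglongrightarrow> (0 + 0) + (0 + 0)"
      by (intro tendsto_add lim filterlim_compose[OF err_tendsto_0 p_lim]
          filterlim_compose[OF escaping_tendsto_0 p_lim])
    then have "measure M ?E \<le> (0 + 0) + (0 + 0)"
      by (rule LIMSEQ_le_const) (use bound in auto)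
    then have "measure M ?E = 0" by (simp add: measure_le_0_iff)
    then show ?thesis
      by (intro AE_I[of _ _ ?E]) (use E in \<open>auto simp: emeasure_eq_measure\<close>)
  qed
  show ?thesis unfolding factor_iff using \<phi> eq by blast
qed

end

section \<open>The equivalence\<close>

lemma mp_action_lattice_action:
  assumes "mp_action M T"
  shows "lattice_action M T"
proof -
  have "prob_space M"
  proof (cases "nonatomic_lebesgue_space M")
    case True
    then show ?thesis by (simp add: nonatomic_lebesgue_space_def)
  next
    case False
    then have M: "finite (space M)" "space M \<noteq> {}" "M = uniform_count_measure (space M)"
      using assms by (auto simp: mp_action_def finite_uniform_space_def)
    show ?thesis by (subst M(3)) (rule prob_space_uniform_count_measure[OF M(1,2)])
  qed
  then show ?thesis
    using assms unfolding lattice_action_def lattice_action_axioms_def mp_action_def by blast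
qed

theorem theorem3p1:
  fixes M :: "'a measure"
    and T :: "int ^ 'd \<Rightarrow> 'a \<Rightarrow> 'a"
    and F :: "nat \<Rightarrow> (int ^ 'd) set"
    and B :: "nat \<Rightarrow> 'a set"
    and G :: "(int ^ 'd) set"
  assumes "mp_action M T"
    and "folner_rank_one M T"
    and "folner_sequence F"
    and "\<And>n. 0 \<in> F n"
    and "rank_one_towers M T F B"
    and "stacking M T F B"
    and "finite_index_subgroup G"
  shows "G \<in> FF M T \<longleftrightarrow>
    (\<forall>\<epsilon>>0. \<exists>N. \<forall>m n. N \<le> m \<longrightarrow> m \<le> n \<longrightarrow>
      (\<exists>g. real (card {i \<in> descendants T F B m n. i - g \<notin> G})
            / real (card (descendants T F B m n)) < \<epsilon>))"
proof -
  interpret lattice_action M T by (rule mp_action_lattice_action[OF assms(1)])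
  interpret stacked_towers M T G F B
    by unfold_locales (use assms in auto)
  show ?thesis
    using factor_imp_congruent_descendants congruent_descendants_imp_factor by blast
qed

end
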